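(* Let $n\ge 1$, let $x,x'\in\mathbb{R}^n$ satisfy $x_i<x'_i$ for all $i=1,\dots,n$, and let $P=\{\eta\in\mathbb{R}^n: x_i\le \eta_i\le x'_i,\ i=1,\dots,n\}$. Then every function $u\in C^n(P)$ satisfies $$u(x')-u(x)=\sum_{k=1}^n\ \sum_{1\le i_1<\dots<i_k\le n}\ \int_{P_{i_1\dots i_k}}\frac{\partial^k u(\eta)}{\partial x_{i_1}\cdots\partial x_{i_k}}\,d\eta_{i_1}\cdots d\eta_{i_k}.$$
   Context: For a subset $\{i_1,\dots,i_k\}\subset\{1,\dots,n\}$ with $1\le k\le n$, the $k$-rectangle $P_{i_1\dots i_k}$ is $$P_{i_1\dots i_k}=P\cap\{\eta\in\mathbb{R}^n:\ \eta_l=x_l \text{ for all } l\notin\{i_1,\dots,i_k\}\},$$ i.e. the $k$-dimensional face of $P$ through the bottom corner $x$ in the directions $i_1,\dots,i_k$ (it equals $P$ when $k=n$). The integral over $P_{i_1\dots i_k}$ is with respect to $k$-dimensional Lebesgue measure in the variables $\eta_{i_1},\dots,\eta_{i_k}$, the remaining coordinates of $\eta$ being frozen at $\eta_l=x_l$. $C^n(P)$ denotes the functions that are $n$ times continuously differentiable on the closed rectangle $P$ (all partial derivatives up to order $n$ exist and are continuous up to the boundary of $P$). *)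

theory Defs
  imports "HOL-Analysis.Analysis"
begin

text \<open>
  Partial derivatives are taken relative to the set \<open>P\<close>, i.e. along the segment
  \<open>{t. \<eta> + t e\<^sub>i \<in> P}\<close>. On a nondegenerate closed rectangle this is the ordinary partial
  derivative at interior points and the one-sided one on faces orthogonal to \<open>e\<^sub>i\<close>;
  values of \<open>f\<close> outside \<open>P\<close> play no role.
\<close>

definition has_partial_on ::
    "(real^'n) set \<Rightarrow> 'n::finite \<Rightarrow> (real^'n \<Rightarrow> real) \<Rightarrow> real^'n \<Rightarrow> bool" where
  "has_partial_on P i f \<eta> \<longleftrightarrow>
     (\<lambda>t. f (\<eta> + t *\<^sub>R axis i 1)) differentiable (at 0 within {t. \<eta> + t *\<^sub>R axis i 1 \<in> P})"

definition partial_on ::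
    "(real^'n) set \<Rightarrow> 'n::finite \<Rightarrow> (real^'n \<Rightarrow> real) \<Rightarrow> real^'n \<Rightarrow> real" where
  "partial_on P i f \<eta> =
     vector_derivative (\<lambda>t. f (\<eta> + t *\<^sub>R axis i 1)) (at 0 within {t. \<eta> + t *\<^sub>R axis i 1 \<in> P})"

text \<open>
  For the list \<open>[i, \<dots>, j]\<close> this is \<open>\<partial>\<^sub>i (\<dots> (\<partial>\<^sub>j f))\<close>:
  the last index is differentiated first.
\<close>

definition partials_on ::
    "(real^'n) set \<Rightarrow> 'n::finite list \<Rightarrow> (real^'n \<Rightarrow> real) \<Rightarrow> real^'n \<Rightarrow> real" where
  "partials_on P is f = foldr (partial_on P) is f"

definition C_k_on :: "nat \<Rightarrow> (real^'n::finite \<Rightarrow> real) \<Rightarrow> (real^'n) set \<Rightarrow> bool" where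
  "C_k_on m f P \<longleftrightarrow>
     (\<forall>is i. length is < m \<longrightarrow> (\<forall>\<eta>\<in>P. has_partial_on P i (partials_on P is f) \<eta>)) \<and>
     (\<forall>is. length is \<le> m \<longrightarrow> continuous_on P (partials_on P is f))"

definition rect_face :: "(real^'n) set \<Rightarrow> real^'n \<Rightarrow> 'n::finite set \<Rightarrow> (real^'n) set" where
  "rect_face P x I = P \<inter> {\<eta>. \<forall>l. l \<notin> I \<longrightarrow> \<eta> $ l = x $ l}"

definition face_point :: "real^'n \<Rightarrow> 'n::finite set \<Rightarrow> ('n \<Rightarrow> real) \<Rightarrow> real^'n" where
  "face_point x I y = (\<chi> l. if l \<in> I then y l else x $ l)"

text \<open>
  The \<open>card I\<close>-dimensional Lebesgue measure is the product of the one-dimensional ones over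
  the index set \<open>I\<close>; \<open>face_point x I\<close> embeds the free variables into the full space with the
  other coordinates frozen at those of \<open>x\<close>.
\<close>

definition face_integral ::
    "(real^'n) set \<Rightarrow> real^'n \<Rightarrow> 'n::finite set \<Rightarrow> (real^'n \<Rightarrow> real) \<Rightarrow> real" where
  "face_integral P x I g =
     set_lebesgue_integral (Pi\<^sub>M I (\<lambda>_. lborel))
       {y \<in> space (Pi\<^sub>M I (\<lambda>_. lborel)). face_point x I y \<in> rect_face P x I}
       (\<lambda>y. g (face_point x I y))"

end

theory Submission
  imports Defs
begin

text \<open>
  The formula is the fundamental theorem of calculus applied once in every coordinate direction.
  Replacing the value \<open>x' $ b\<close> of one coordinate \<open>b\<close> by \<open>x $ b\<close> changes a function \<open>g\<close> by the integral
  of \<open>\<partial>\<^sub>b g\<close> over that coordinate. Doing this under the integral sign, for a \<open>g\<close> that is already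
  integrated over the face in the directions \<open>I\<close>, splits that face integral into one over the same
  face through a lower base point and, by Fubini, one of \<open>\<partial>\<^sub>b g\<close> over the face in the directions
  \<open>insert b I\<close> (lemma \<open>face_integral_shift_base\<close>).

  Starting from \<open>u x'\<close> and lowering the coordinates one after the other, each term of the current sum
  thus branches into two, and after all coordinates have been lowered there is exactly one term for
  each set \<open>I\<close> of directions, based at the corner \<open>x\<close> (lemma \<open>corner_expansion\<close>). The term for
  \<open>I = {}\<close> is \<open>u x\<close>. The coordinates are lowered from the largest index to the smallest: a newly
  applied \<open>\<partial>\<^sub>b\<close> is then the outermost derivative and has the smallest index, which is the order in
  which \<open>partials_on\<close> reads the sorted list of \<open>I\<close>. Hence partial derivatives are never
  interchanged.
\<close>

section \<open>Faces of a box\<close>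

lemma face_point_empty [simp]: "face_point w {} y = w"
  by (simp add: face_point_def vec_eq_iff)

lemma face_point_in_cbox_iff:
  fixes w x x' :: "real^'n::finite"
  assumes "w \<in> cbox x x'"
  shows "face_point w I y \<in> cbox x x' \<longleftrightarrow> (\<forall>i\<in>I. x $ i \<le> y i \<and> y i \<le> x' $ i)"
  using assms by (auto simp: face_point_def mem_box_cart)

text \<open>The face through any base point of the box, not only through its bottom corner, is
  parametrised by the same product of intervals.\<close>

lemma face_integral_eq_PiE:
  fixes w x x' :: "real^'n::finite"
  assumes "w \<in> cbox x x'"
  shows "face_integral (cbox x x') w I g =
    (\<integral>y. indicator (PiE I (\<lambda>i. {x $ i..x' $ i})) y *\<^sub>R g (face_point w I y) \<partial>Pi\<^sub>M I (\<lambda>_. lborel))"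
proof -
  have "face_point w I y \<in> rect_face (cbox x x') w I \<longleftrightarrow> (\<forall>i\<in>I. x $ i \<le> y i \<and> y i \<le> x' $ i)" for y
    by (simp add: rect_face_def face_point_in_cbox_iff[OF assms]) (simp add: face_point_def)
  then have "{y \<in> space (Pi\<^sub>M I (\<lambda>_. lborel)). face_point w I y \<in> rect_face (cbox x x') w I}
      = PiE I (\<lambda>i. {x $ i..x' $ i})"
    by (auto simp: space_PiM PiE_iff extensional_def)
  then show ?thesis
    by (simp add: face_integral_def set_lebesgue_integral_def)
qed

lemma face_integral_empty:
  fixes w x x' :: "real^'n::finite"
  assumes "w \<in> cbox x x'"
  shows "face_integral (cbox x x') w {} g = g w"
  by (simp add: face_integral_eq_PiE[OF assms] PiM_empty lebesgue_integral_count_space_finite)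

lemma measurable_face_point:
  fixes w :: "real^'n::finite"
  shows "face_point w I \<in> borel_measurable (Pi\<^sub>M I (\<lambda>_. lborel))"
proof -
  have "(\<lambda>y. \<Sum>l\<in>UNIV. (if l \<in> I then y l else w $ l) *\<^sub>R (axis l 1 :: real^'n))
      \<in> borel_measurable (Pi\<^sub>M I (\<lambda>_. lborel))"
  proof (intro borel_measurable_sum borel_measurable_scaleR borel_measurable_const)
    fix l :: 'n
    show "(\<lambda>y. if l \<in> I then y l else w $ l) \<in> borel_measurable (Pi\<^sub>M I (\<lambda>_. lborel))"
    proof (cases "l \<in> I")
      case True
      then have "(\<lambda>y. y l) \<in> measurable (Pi\<^sub>M I (\<lambda>_. lborel)) (lborel :: real measure)"
        by (rule measurable_component_singleton)
      with True show ?thesis by simp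
    qed simp
  qed
  also have "(\<lambda>y. \<Sum>l\<in>UNIV. (if l \<in> I then y l else w $ l) *\<^sub>R (axis l 1 :: real^'n)) = face_point w I"
    using basis_expansion[of "face_point w I _"]
    by (simp add: fun_eq_iff scalar_mult_eq_scaleR face_point_def)
  finally show ?thesis .
qed

text \<open>A continuous function is bounded on the compact box, and the parameter domain of a face has
  finite measure. This is what licenses Fubini below.\<close>

lemma integrable_on_face:
  fixes w x x' :: "real^'n::finite" and g :: "real^'n \<Rightarrow> real"
  assumes w: "w \<in> cbox x x'" and g: "continuous_on (cbox x x') g"
  shows "integrable (Pi\<^sub>M I (\<lambda>_. lborel))
    (\<lambda>y. indicator (PiE I (\<lambda>i. {x $ i..x' $ i})) y *\<^sub>R g (face_point w I y))"
proof -
  interpret product_sigma_finite "\<lambda>_::'n. lborel :: real measure"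
    by standard
  let ?A = "PiE I (\<lambda>i. {x $ i..x' $ i})"
  let ?M = "Pi\<^sub>M I (\<lambda>_. lborel :: real measure)"
  have A: "?A \<in> sets ?M"
    by (intro sets_PiM_I_finite) auto
  have "emeasure ?M ?A = (\<Prod>i\<in>I. emeasure lborel {x $ i..x' $ i})"
    by (intro emeasure_PiM) auto
  also have "\<dots> < \<infinity>"
    using w by (auto simp: mem_box_cart less_top[symmetric] ennreal_prod_eq_top emeasure_lborel_Icc_eq)
  finally have fin: "emeasure ?M ?A < \<infinity>" .
  have "bounded (g ` cbox x x')"
    by (intro compact_imp_bounded compact_continuous_image g compact_cbox)
  then obtain B where B: "\<And>\<eta>. \<eta> \<in> cbox x x' \<Longrightarrow> \<bar>g \<eta>\<bar> \<le> B"
    by (auto simp: bounded_iff)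
  \<comment> \<open>Nothing is known about \<open>g\<close> outside the box, so measurability is obtained for its cut-off.\<close>
  have "(\<lambda>\<eta>. indicator (cbox x x') \<eta> *\<^sub>R g \<eta>) \<in> borel_measurable borel"
    by (intro borel_measurable_continuous_on_indicator g) auto
  from measurable_compose[OF measurable_face_point this]
  have "(\<lambda>y. indicator ?A y *\<^sub>R (indicator (cbox x x') (face_point w I y) *\<^sub>R g (face_point w I y)))
      \<in> borel_measurable ?M"
    by (rule borel_measurable_scaleR[OF borel_measurable_indicator[OF A]])
  also have "(\<lambda>y. indicator ?A y *\<^sub>R (indicator (cbox x x') (face_point w I y) *\<^sub>R g (face_point w I y)))
      = (\<lambda>y. indicator ?A y *\<^sub>R g (face_point w I y))"
    by (auto simp: fun_eq_iff face_point_in_cbox_iff[OF w] PiE_iff indicator_def)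
  finally have meas: "(\<lambda>y. indicator ?A y *\<^sub>R g (face_point w I y)) \<in> borel_measurable ?M" .
  show ?thesis
    by (rule integrableI_bounded_set[OF A meas fin, of B])
       (auto simp: face_point_in_cbox_iff[OF w] PiE_iff indicator_def intro!: AE_I2 B)
qed

section \<open>Lowering one coordinate\<close>

text \<open>\<open>partial_on\<close> differentiates at \<open>0\<close> in the increment of the coordinate; translating by \<open>s\<close> makes
  the coordinate itself the variable, as the one-dimensional fundamental theorem requires.\<close>

lemma has_vector_derivative_partial_on:
  fixes f :: "real^'n::finite \<Rightarrow> real"
  assumes v: "v \<in> cbox x x'" and s: "s \<in> {x $ b..x' $ b}"
    and f: "has_partial_on (cbox x x') b f (face_point v {b} (\<lambda>_. s))"
  shows "((\<lambda>s. f (face_point v {b} (\<lambda>_. s))) has_vector_derivative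
    partial_on (cbox x x') b f (face_point v {b} (\<lambda>_. s))) (at s within {x $ b..x' $ b})"
proof -
  let ?p = "\<lambda>s. face_point v {b} (\<lambda>_. s)"
  have shift: "?p s + t *\<^sub>R axis b 1 = ?p (s + t)" for t
    by (auto simp: face_point_def vec_eq_iff axis_def)
  have "{t. ?p s + t *\<^sub>R axis b 1 \<in> cbox x x'} = (\<lambda>r. r - s) ` {x $ b..x' $ b}"
    by (auto simp: shift face_point_in_cbox_iff[OF v] image_iff intro: bexI[of _ "s + _"])
  then have "((\<lambda>t. f (?p (s + t))) has_vector_derivative partial_on (cbox x x') b f (?p s))
      (at 0 within (\<lambda>r. r - s) ` {x $ b..x' $ b})"
    using f by (simp add: has_partial_on_def partial_on_def vector_derivative_works shift)
  then have "((\<lambda>t. f (?p (s + t))) \<circ> (\<lambda>r. r - s) has_vector_derivative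
      1 *\<^sub>R partial_on (cbox x x') b f (?p s)) (at s within {x $ b..x' $ b})"
    by (intro vector_diff_chain_within) (auto intro!: derivative_eq_intros)
  then show ?thesis
    by (simp add: o_def)
qed

lemma continuous_on_face_point_line:
  "continuous_on A (\<lambda>s. face_point v {b} (\<lambda>_. s))"
proof -
  have "continuous_on A (\<lambda>s. if l \<in> {b} then s else v $ l)" for l
    by (cases "l \<in> {b}") simp_all
  then show ?thesis
    unfolding face_point_def by (intro continuous_on_vec_lambda)
qed

lemma integral_partial_on:
  fixes f :: "real^'n::finite \<Rightarrow> real"
  assumes v: "v \<in> cbox x x'"
    and f: "\<And>\<eta>. \<eta> \<in> cbox x x' \<Longrightarrow> has_partial_on (cbox x x') b f \<eta>"
    and cont: "continuous_on (cbox x x') (partial_on (cbox x x') b f)"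
  shows "(\<integral>s. indicator {x $ b..x' $ b} s *\<^sub>R
      partial_on (cbox x x') b f (face_point v {b} (\<lambda>_. s)) \<partial>lborel)
    = f (face_point v {b} (\<lambda>_. x' $ b)) - f (face_point v {b} (\<lambda>_. x $ b))"
proof (rule integral_FTC_Icc)
  have line: "face_point v {b} (\<lambda>_. s) \<in> cbox x x'" if "s \<in> {x $ b..x' $ b}" for s
    using that by (simp add: face_point_in_cbox_iff[OF v])
  show "x $ b \<le> x' $ b"
    using v by (meson mem_box_cart(2) order_trans)
  show "((\<lambda>s. f (face_point v {b} (\<lambda>_. s))) has_vector_derivative
      partial_on (cbox x x') b f (face_point v {b} (\<lambda>_. s))) (at s within {x $ b..x' $ b})"
    if "x $ b \<le> s" "s \<le> x' $ b" for s
    using that by (intro has_vector_derivative_partial_on v f line) auto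
  show "continuous_on {x $ b..x' $ b} (\<lambda>s. partial_on (cbox x x') b f (face_point v {b} (\<lambda>_. s)))"
    by (rule continuous_on_compose2[OF cont continuous_on_face_point_line]) (auto intro: line)
qed

text \<open>The fundamental theorem of calculus in direction \<open>b\<close>, applied at every point of a face in other
  directions; Fubini merges the two integrations of the error term.\<close>

lemma face_integral_shift_base:
  fixes w x x' :: "real^'n::finite" and g :: "real^'n \<Rightarrow> real"
  assumes w: "w \<in> cbox x x'" and b: "b \<notin> I"
    and g: "continuous_on (cbox x x') g"
    and dg: "\<And>\<eta>. \<eta> \<in> cbox x x' \<Longrightarrow> has_partial_on (cbox x x') b g \<eta>"
    and cont: "continuous_on (cbox x x') (partial_on (cbox x x') b g)"
  shows "face_integral (cbox x x') (face_point w {b} (($) x')) I g =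
    face_integral (cbox x x') (face_point w {b} (($) x)) I g +
    face_integral (cbox x x') (face_point w {b} (($) x)) (insert b I) (partial_on (cbox x x') b g)"
proof -
  interpret product_sigma_finite "\<lambda>_::'n. lborel :: real measure"
    by standard
  let ?hi = "face_point w {b} (($) x')" and ?lo = "face_point w {b} (($) x)"
  let ?J = "\<lambda>i. {x $ i..x' $ i}"
  let ?M = "Pi\<^sub>M I (\<lambda>_. lborel :: real measure)"
  let ?d = "partial_on (cbox x x') b g"
  have le: "x $ b \<le> x' $ b"
    using w by (meson mem_box_cart(2) order_trans)
  have hi: "?hi \<in> cbox x x'" and lo: "?lo \<in> cbox x x'"
    using le by (auto simp: face_point_in_cbox_iff[OF w])
  have "face_integral (cbox x x') ?lo (insert b I) ?d =
      (\<integral>y. (\<integral>s. indicator (PiE (insert b I) ?J) (y(b := s)) *\<^sub>R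
        ?d (face_point ?lo (insert b I) (y(b := s))) \<partial>lborel) \<partial>?M)"
    unfolding face_integral_eq_PiE[OF lo]
    by (rule product_integral_insert[OF _ b integrable_on_face[OF lo cont]]) simp
  also have "\<dots> = (\<integral>y. indicator (PiE I ?J) y *\<^sub>R g (face_point ?hi I y) -
      indicator (PiE I ?J) y *\<^sub>R g (face_point ?lo I y) \<partial>?M)"
  proof (rule Bochner_Integration.integral_cong[OF refl])
    fix y assume y: "y \<in> space ?M"
    have ind: "indicator (PiE (insert b I) ?J) (y(b := s)) =
        (indicator (PiE I ?J) y * indicator (?J b) s :: real)" for s
      using y b by (auto simp: indicator_def PiE_iff space_PiM extensional_def fun_upd_def)
    have pt: "face_point ?lo (insert b I) (y(b := s)) = face_point (face_point ?lo I y) {b} (\<lambda>_. s)"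
      "face_point (face_point ?lo I y) {b} (\<lambda>_. x' $ b) = face_point ?hi I y"
      "face_point (face_point ?lo I y) {b} (\<lambda>_. x $ b) = face_point ?lo I y" for s
      using b by (auto simp: face_point_def vec_eq_iff)
    show "(\<integral>s. indicator (PiE (insert b I) ?J) (y(b := s)) *\<^sub>R
        ?d (face_point ?lo (insert b I) (y(b := s))) \<partial>lborel) =
      indicator (PiE I ?J) y *\<^sub>R g (face_point ?hi I y) -
      indicator (PiE I ?J) y *\<^sub>R g (face_point ?lo I y)"
    proof (cases "y \<in> PiE I ?J")
      case True
      then have "face_point ?lo I y \<in> cbox x x'"
        by (auto simp: face_point_in_cbox_iff[OF lo] PiE_iff)
      from integral_partial_on[OF this dg cont] True show ?thesis
        by (simp add: ind pt)
    qed (simp add: ind)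
  qed
  also have "\<dots> = face_integral (cbox x x') ?hi I g - face_integral (cbox x x') ?lo I g"
    unfolding face_integral_eq_PiE[OF hi] face_integral_eq_PiE[OF lo]
    by (rule Bochner_Integration.integral_diff; rule integrable_on_face[OF _ g]; fact hi lo)
  finally show ?thesis by simp
qed

section \<open>Lowering all coordinates\<close>

lemma partials_on_Cons: "partials_on P (i # is) f = partial_on P i (partials_on P is f)"
  by (simp add: partials_on_def)

text \<open>The base point \<open>w\<close> is arbitrary so that the induction hypothesis can be used at the base point
  whose coordinate \<open>b\<close> is still raised. The induction inserts \<open>b\<close> below all indices treated so far.\<close>

lemma corner_expansion:
  fixes w x x' :: "real^'n::{finite,linorder}" and u :: "real^'n::{finite,linorder} \<Rightarrow> real"
  assumes u: "C_k_on CARD('n) u (cbox x x')"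
    and w: "w \<in> cbox x x'"
  shows "u (face_point w S (($) x')) =
    (\<Sum>I\<in>Pow S. face_integral (cbox x x') (face_point w S (($) x)) I
      (partials_on (cbox x x') (sorted_list_of_set I) u))"
  using finite[of S] w
proof (induction S arbitrary: w rule: finite_linorder_min_induct)
  case empty
  then show ?case
    by (simp add: face_integral_empty partials_on_def)
next
  case (insert b S)
  let ?P = "cbox x x'"
  let ?D = "\<lambda>I. partials_on ?P (sorted_list_of_set I) u"
  let ?low = "\<lambda>S. face_point w S (($) x)"
  have b: "b \<notin> S"
    using insert.hyps by auto
  have le: "x $ i \<le> x' $ i" for i
    using \<open>w \<in> ?P\<close> by (meson mem_box_cart(2) order_trans)
  have hi: "face_point w {b} (($) x') \<in> ?P" and low: "?low S \<in> ?P"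
    using le by (auto simp: face_point_in_cbox_iff[OF \<open>w \<in> ?P\<close>])
  have comm: "face_point (face_point w {b} (($) x')) S (($) x) = face_point (?low S) {b} (($) x')"
    "face_point (?low S) {b} (($) x) = ?low (insert b S)"
    "face_point (face_point w {b} (($) x')) S (($) x') = face_point w (insert b S) (($) x')"
    using b by (auto simp: face_point_def vec_eq_iff)
  have step: "face_integral ?P (face_point (?low S) {b} (($) x')) I (?D I) =
      face_integral ?P (?low (insert b S)) I (?D I) +
      face_integral ?P (?low (insert b S)) (insert b I) (?D (insert b I))" if "I \<in> Pow S" for I
  proof -
    have bI: "b \<notin> I" "\<forall>i\<in>I. b < i"
      using that insert.hyps by auto
    \<comment> \<open>Since \<open>b\<close> is smaller than all indices in \<open>I\<close>, the new derivative is the outermost one.\<close>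
    then have "sorted_list_of_set (insert b I) = b # sorted_list_of_set I"
      by (simp add: insort_is_Cons less_imp_le)
    then have D: "?D (insert b I) = partial_on ?P b (?D I)"
      by (simp add: partials_on_Cons)
    have "card (insert b I) \<le> CARD('n)"
      by (rule card_mono) auto
    then have len: "length (sorted_list_of_set I) < CARD('n)"
      "length (sorted_list_of_set (insert b I)) \<le> CARD('n)"
      using bI by (auto simp del: sorted_list_of_set_insert)
    have "continuous_on ?P (?D I)" "continuous_on ?P (?D (insert b I))"
      "\<And>\<eta>. \<eta> \<in> ?P \<Longrightarrow> has_partial_on ?P b (?D I) \<eta>"
      using u len unfolding C_k_on_def by (meson less_imp_le)+
    from face_integral_shift_base[OF low \<open>b \<notin> I\<close> this(1,3)] this(2) show ?thesis
      by (simp only: D comm)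
  qed
  have inj: "inj_on (insert b) (Pow S)"
    using b by (auto simp: inj_on_def)
  have "u (face_point w (insert b S) (($) x')) =
      (\<Sum>I\<in>Pow S. face_integral ?P (face_point (?low S) {b} (($) x')) I (?D I))"
    using insert.IH[OF hi] by (simp only: comm)
  also have "\<dots> = (\<Sum>I\<in>Pow S. face_integral ?P (?low (insert b S)) I (?D I)) +
      (\<Sum>I\<in>Pow S. face_integral ?P (?low (insert b S)) (insert b I) (?D (insert b I)))"
    by (simp only: step sum.distrib cong: sum.cong)
  also have "\<dots> = (\<Sum>I\<in>Pow S. face_integral ?P (?low (insert b S)) I (?D I)) +
      (\<Sum>I\<in>insert b ` Pow S. face_integral ?P (?low (insert b S)) I (?D I))"
    by (simp only: sum.reindex[OF inj] o_def)
  also have "\<dots> = (\<Sum>I\<in>Pow (insert b S). face_integral ?P (?low (insert b S)) I (?D I))"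
    unfolding Pow_insert by (rule sum.union_disjoint[symmetric]) (use b in auto)
  finally show ?case .
qed

theorem theorem1:
  fixes x x' :: "real^'n::{finite,linorder}"
    and P :: "(real^'n::{finite,linorder}) set"
    and u :: "real^'n::{finite,linorder} \<Rightarrow> real"
  assumes "\<And>i. x $ i < x' $ i"
    and "P = {\<eta>. \<forall>i. x $ i \<le> \<eta> $ i \<and> \<eta> $ i \<le> x' $ i}"
    and "C_k_on CARD('n) u P"
  shows "u x' - u x =
    (\<Sum>k = 1..CARD('n). \<Sum>I | I \<subseteq> (UNIV :: 'n set) \<and> card I = k.
       face_integral P x I (partials_on P (sorted_list_of_set I) u))"
proof -
  let ?F = "\<lambda>I. face_integral P x I (partials_on P (sorted_list_of_set I) u)"
  have P: "P = cbox x x'"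
    using assms(2) by (auto simp: mem_box_cart)
  have x: "x \<in> cbox x x'"
    using assms(1) by (simp add: mem_box_cart less_imp_le)
  have "face_point x UNIV (($) y) = y" for y :: "real^'n::{finite,linorder}"
    by (simp add: face_point_def)
  then have "u x' = (\<Sum>I\<in>UNIV. ?F I)"
    using corner_expansion[of u x x' x UNIV] assms(3) x by (simp add: P)
  also have "\<dots> = ?F {} + (\<Sum>I\<in>UNIV - {{}}. ?F I)"
    by (rule sum.remove) auto
  also have "?F {} = u x"
    unfolding P using x by (simp add: face_integral_empty partials_on_def)
  also have "(\<Sum>I\<in>UNIV - {{}}. ?F I) =
      (\<Sum>k = 1..CARD('n). \<Sum>I | I \<in> UNIV - {{}} \<and> card I = k. ?F I)"
    by (rule sum.group[symmetric]) (auto simp: Suc_le_eq card_gt_0_iff intro: card_mono[OF finite subset_UNIV])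
  also have "\<dots> = (\<Sum>k = 1..CARD('n). \<Sum>I | I \<subseteq> (UNIV :: 'n set) \<and> card I = k. ?F I)"
    by (intro sum.cong) auto
  finally show ?thesis by simp
qed

end
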